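(* Let $n$ be a positive integer and let $J - I = XY$ be a factorization into $n \times n$ integral matrices $X$ and $Y$. Suppose also that $XJ = rJ$. Then $$ Y = \frac{1}{r} J - X^{-1}.$$
   Context: $J$ denotes the $n \times n$ all-ones matrix and $I$ denotes the $n \times n$ identity matrix.
   Formalization: For n = 1 the formal statement additionally assumes r ≠ 0: with n = 1, X = [0], r = 0 and Y any integer, all hypotheses hold but 1/r and X^{-1} do not exist. For n ≥ 2 nothing is added, and r ≠ 0 and the invertibility of X are proved. *)

theory Defs
  imports "HOL-Analysis.Analysis"
begin

definition all_ones :: "real ^ 'n ^ 'n" where
  "all_ones = (\<chi> i j. 1)"

definition integral_matrix :: "real ^ 'n ^ 'm \<Rightarrow> bool" where
  "integral_matrix A \<longleftrightarrow> (\<forall>i j. A $ i $ j \<in> \<int>)"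

end

theory Submission
  imports Defs
begin

text \<open>Write J for \<open>all_ones\<close> and I for \<open>mat 1\<close>. If r is nonzero,
  then X((1/r)J - Y) = J - (J - I) = I, and a one-sided inverse of a square matrix is two-sided, so
  (1/r)J - Y is the inverse of X. That r is nonzero follows for n \<noteq> 1 from the invertibility
  of J - I (\<open>all_ones_minus_mat_right_inverse\<close>), which makes X invertible, so that XJ
  cannot vanish. For n = 1 the product XY is 0 and X = 0, r = 0 is possible, so there r \<noteq> 0
  is assumed.\<close>

lemma matrix_diff_ldistrib:
  fixes A :: "'a::ring_1 ^ 'n ^ 'm"
  shows "A ** (B - C) = A ** B - A ** C"
  by (simp add: matrix_matrix_mult_def vec_eq_iff right_diff_distrib sum_subtractf)

lemma matrix_diff_rdistrib:
  fixes A :: "'a::ring_1 ^ 'n ^ 'm"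
  shows "(A - B) ** C = A ** C - B ** C"
  by (simp add: matrix_matrix_mult_def vec_eq_iff left_diff_distrib sum_subtractf)

text \<open>\<open>matrix_inv\<close> is a choice among two-sided inverses; any such C equals C(AB)
  = (CA)B = B.\<close>

lemma matrix_inv_unique:
  fixes A :: "'a::semiring_1 ^ 'n ^ 'm"
  assumes "A ** B = mat 1" and "B ** A = mat 1"
  shows "matrix_inv A = B"
  unfolding matrix_inv_def
proof (rule some_equality)
  fix C
  assume "A ** C = mat 1 \<and> C ** A = mat 1"
  then show "C = B"
    by (metis assms(1) matrix_mul_assoc matrix_mul_lid matrix_mul_rid)
qed (use assms in simp)

lemma all_ones_mult_all_ones:
  "(all_ones :: real ^ 'n ^ 'n) ** all_ones = real CARD('n) *\<^sub>R all_ones"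
  by (simp add: all_ones_def matrix_matrix_mult_def vec_eq_iff)

text \<open>Since J^2 = nJ, an inverse can be sought as cJ - I: the product is (cn - c - 1)J + I,
  which forces c(n - 1) = 1.\<close>

lemma all_ones_minus_mat_right_inverse:
  assumes "CARD('n) \<noteq> 1"
  shows "(all_ones - mat 1 :: real ^ 'n ^ 'n) **
    ((1 / (real CARD('n) - 1)) *\<^sub>R all_ones - mat 1) = mat 1"
proof -
  define c where "c = 1 / (real CARD('n) - 1)"
  have "real CARD('n) - 1 \<noteq> 0"
    using assms by simp
  then have c: "c * real CARD('n) - c = 1"
    by (simp add: c_def diff_divide_distrib[symmetric])
  have "(all_ones - mat 1 :: real ^ 'n ^ 'n) ** (c *\<^sub>R all_ones - mat 1)
      = (c * real CARD('n) - c) *\<^sub>R all_ones - all_ones + mat 1"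
    by (simp add: matrix_diff_ldistrib matrix_diff_rdistrib matrix_scalar_ac
        all_ones_mult_all_ones scaleR_diff_left scaleR_diff_right flip: scalar_matrix_assoc)
  with c show ?thesis
    by (simp add: c_def)
qed

theorem theorem1p4:
  fixes X Y :: "real ^ 'n ^ 'n" and r :: real
  assumes "integral_matrix X" and "integral_matrix Y"
    and "all_ones - mat 1 = X ** Y"
    and "X ** all_ones = r *\<^sub>R all_ones"
    and "CARD('n) = 1 \<longrightarrow> r \<noteq> 0"
  shows "invertible X \<and> r \<noteq> 0 \<and> Y = (1 / r) *\<^sub>R all_ones - matrix_inv X"
proof -
  have "r \<noteq> 0"
  proof
    assume "r = 0"
    with assms(5) have "CARD('n) \<noteq> 1"
      by simp
    \<comment> \<open>Z is Y times the right inverse of J - I = XY.\<close>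
    from all_ones_minus_mat_right_inverse[OF this] obtain Z where "X ** Z = mat 1"
      unfolding assms(3) by (metis matrix_mul_assoc)
    then have "Z ** X = mat 1"
      by (simp add: matrix_left_right_inverse)
    then have "(all_ones :: real ^ 'n ^ 'n) = Z ** (X ** all_ones)"
      by (simp add: matrix_mul_assoc)
    also have "\<dots> = 0"
      using assms(4) \<open>r = 0\<close> by (simp add: matrix_matrix_mult_def vec_eq_iff)
    finally show False
      by (simp add: all_ones_def vec_eq_iff)
  qed
  \<comment> \<open>The claimed formula solved for the inverse of X.\<close>
  define W where "W = (1 / r) *\<^sub>R all_ones - Y"
  have "X ** W = (1 / r) *\<^sub>R (X ** all_ones) - X ** Y"
    by (simp add: W_def matrix_diff_ldistrib matrix_scalar_ac scalar_matrix_assoc)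
  also have "\<dots> = mat 1"
    using \<open>r \<noteq> 0\<close> by (simp add: assms(4) flip: assms(3))
  finally have XW: "X ** W = mat 1" .
  then have WX: "W ** X = mat 1"
    by (simp add: matrix_left_right_inverse)
  from XW WX have "invertible X"
    by (auto simp: invertible_def)
  with matrix_inv_unique[OF XW WX] \<open>r \<noteq> 0\<close> show ?thesis
    by (simp add: W_def)
qed

end
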